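(* For every natural number $n \ge 6$, $$ES(n) \le \binom{2n-5}{n-2}-\binom{2n-8}{n-3}+2,$$ where $ES(n)$ denotes the minimum natural number such that every set of $ES(n)$ points in general position in the plane contains $n$ points in convex position.
   Context: A finite set of points in the plane is in general position if no three of its points are collinear. Points are in convex position if they are the vertices of a convex polygon. *)

theory Defs
  imports "HOL-Analysis.Analysis"
begin

definition general_position :: "(real^2) set \<Rightarrow> bool" where
  "general_position S \<longleftrightarrow>
     finite S \<and> (\<forall>T. T \<subseteq> S \<and> card T = 3 \<longrightarrow> \<not> collinear T)"

definition convex_polygon :: "(real^2) set \<Rightarrow> bool" where
  "convex_polygon P \<longleftrightarrow> polytope P \<and> aff_dim P = 2"

definition convex_position :: "(real^2) set \<Rightarrow> bool" where
  "convex_position T \<longleftrightarrow>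
     (\<exists>P. convex_polygon P \<and> T = {v. v extreme_point_of P})"

definition ES :: "nat \<Rightarrow> nat" where
  "ES n = (LEAST N. \<forall>S. general_position S \<and> card S = N \<longrightarrow>
             (\<exists>T. T \<subseteq> S \<and> card T = n \<and> convex_position T))"

end

theory Submission imports Defs begin

text \<open>
  Following Toth and Valtr, fix a vertex x of the convex hull and order the remaining points by
  angle around x. Call a triple a < b < c a cap if x, a, b, c are in convex position, and a cup
  otherwise. Then n-cups, (n-1)-caps together with x, and (n-1)-cups together with a
  point above their chord are all convex n-gons. Suppose that none of them occurs.

  Let A consist of starting points of (n-1)-cups whose other points lie outside A, chosen such that
  every (n-1)-cup meets A, and let B be the set of end points of (n-1)-cups contained in A. By the
  Erdos-Szekeres bound the complement of A has at most C(2n-6, n-3) points, and A - B, which has no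
  (n-2)-cap, at most C(2n-7, n-3). The new point is that B has no (n-4)-cap: such a cap
  b1, b2, ... extends by one point to the right. Let y precede b1 in an (n-1)-cup inside A, and let
  r2, r1, r be the last three points of an (n-1)-cup starting at y; since r is outside A, it
  differs from b1. If r lies to the right of b1, then y, b1, r gives an n-cup or a covered
  (n-1)-cup. If r lies to the left of b1, then r must be above the line b1 b2 (otherwise r1, r
  extend the cap to an (n-1)-cap). If r1 is above that line as well, appending r1, r to the cup
  ending at y gives an n-cup; if r1 is below it, replacing r by b1 gives an (n-1)-cup covered by r.
  Hence B has at most C(2n-8, n-2) points, and the three bounds add up to
  C(2n-5, n-2) - C(2n-8, n-3).
\<close>

section \<open>Cups and caps\<close>

text \<open>The predicate is left arbitrary so that cups (\<open>Q\<close>) and caps (its negation)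
  are two instances of one notion. Sets with at most two elements qualify vacuously.\<close>

definition homogeneous :: "('a::linorder \<Rightarrow> 'a \<Rightarrow> 'a \<Rightarrow> bool) \<Rightarrow> 'a set \<Rightarrow> bool" where
  "homogeneous Q K \<longleftrightarrow> (\<forall>a\<in>K. \<forall>b\<in>K. \<forall>c\<in>K. a < b \<longrightarrow> b < c \<longrightarrow> Q a b c)"

lemma homogeneousD:
  "homogeneous Q K \<Longrightarrow> a \<in> K \<Longrightarrow> b \<in> K \<Longrightarrow> c \<in> K \<Longrightarrow> a < b \<Longrightarrow> b < c \<Longrightarrow> Q a b c"
  unfolding homogeneous_def by blast

lemma homogeneous_subset: "homogeneous Q K \<Longrightarrow> L \<subseteq> K \<Longrightarrow> homogeneous Q L"
  unfolding homogeneous_def by blast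

text \<open>Together with its mirror image below, this supplies the last or first edge of a cup or
  cap; the extension lemmas need nothing else about the set.\<close>

lemma ex_predecessor_of_greatest:
  fixes K :: "'a::linorder set"
  assumes "finite K" "2 \<le> card K" "p \<in> K" "\<And>z. z \<in> K \<Longrightarrow> z \<le> p"
  obtains u where "u \<in> K" "u < p" "\<And>z. z \<in> K \<Longrightarrow> z \<le> u \<or> z = p"
proof -
  have ne: "K - {p} \<noteq> {}"
  proof
    assume "K - {p} = {}"
    then have "K = {p}" using assms(3) by blast
    then show False using assms(2) by simp
  qed
  have fin: "finite (K - {p})" using assms(1) by simp
  have "Max (K - {p}) \<in> K - {p}" using Max_in[OF fin ne] .
  then show thesis
    using that[of "Max (K - {p})"] assms(4) Max_ge[OF fin]
    by (metis DiffD1 DiffD2 DiffI order_le_imp_less_or_eq singletonI singletonD)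
qed

lemma ex_successor_of_least:
  fixes K :: "'a::linorder set"
  assumes "finite K" "2 \<le> card K" "p \<in> K" "\<And>z. z \<in> K \<Longrightarrow> p \<le> z"
  obtains u where "u \<in> K" "p < u" "\<And>z. z \<in> K \<Longrightarrow> u \<le> z \<or> z = p"
proof -
  have ne: "K - {p} \<noteq> {}"
  proof
    assume "K - {p} = {}"
    then have "K = {p}" using assms(3) by blast
    then show False using assms(2) by simp
  qed
  have fin: "finite (K - {p})" using assms(1) by simp
  have "Min (K - {p}) \<in> K - {p}" using Min_in[OF fin ne] .
  then show thesis
    using that[of "Min (K - {p})"] assms(4) Min_le[OF fin]
    by (metis DiffD1 DiffD2 DiffI order_le_imp_less_or_eq singletonI singletonD)
qed

text \<open>The greedy choice from right to left makes every chosen point the only chosen point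
  of its cup.\<close>

lemma ex_greedy_hitting_set:
  fixes V :: "'a::linorder set"
  assumes "finite V" and k: "0 < k"
  obtains A where "A \<subseteq> V"
    "\<And>a. a \<in> A \<Longrightarrow> \<exists>K\<subseteq>V. homogeneous Q K \<and> card K = k \<and> a \<in> K \<and> (\<forall>z\<in>K. z \<noteq> a \<longrightarrow> a < z \<and> z \<notin> A)"
    "\<And>K. K \<subseteq> V - A \<Longrightarrow> homogeneous Q K \<Longrightarrow> card K \<noteq> k"
proof -
  have "\<exists>A\<subseteq>V.
    (\<forall>a\<in>A. \<exists>K\<subseteq>V. homogeneous Q K \<and> card K = k \<and> a \<in> K \<and> (\<forall>z\<in>K. z \<noteq> a \<longrightarrow> a < z \<and> z \<notin> A)) \<and>
    (\<forall>K. K \<subseteq> V - A \<longrightarrow> homogeneous Q K \<longrightarrow> card K \<noteq> k)"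
    using assms(1)
  proof (induction V rule: finite_linorder_min_induct)
    case empty
    then show ?case using k by auto
  next
    \<comment> \<open>Here \<open>b\<close> is smaller than all of \<open>W\<close>. It joins
      \<open>A\<close> exactly when it completes a homogeneous \<open>k\<close>-set with points of
      \<open>W - A\<close>. Witnesses found earlier lie in \<open>W\<close>, so they avoid
      \<open>b\<close> and stay valid.\<close>
    case (insert b W)
    from insert.IH obtain A where A: "A \<subseteq> W"
      "\<forall>a\<in>A. \<exists>K\<subseteq>W. homogeneous Q K \<and> card K = k \<and> a \<in> K \<and> (\<forall>z\<in>K. z \<noteq> a \<longrightarrow> a < z \<and> z \<notin> A)"
      "\<forall>K. K \<subseteq> W - A \<longrightarrow> homogeneous Q K \<longrightarrow> card K \<noteq> k"
      by (elim exE conjE) (rule that; assumption)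
    have b: "b \<notin> W" using insert.hyps by auto
    show ?case
    proof (cases "\<exists>K\<subseteq>W - A. homogeneous Q (insert b K) \<and> card (insert b K) = k")
      case True
      then obtain K where K: "K \<subseteq> W - A" "homogeneous Q (insert b K)" "card (insert b K) = k"
        by blast
      have "\<exists>K\<subseteq>insert b W. homogeneous Q K \<and> card K = k \<and> a \<in> K \<and>
          (\<forall>z\<in>K. z \<noteq> a \<longrightarrow> a < z \<and> z \<notin> insert b A)" if "a \<in> insert b A" for a
      proof (cases "a = b")
        case True
        have "insert b K \<subseteq> insert b W \<and> (\<forall>z\<in>insert b K. z \<noteq> b \<longrightarrow> b < z \<and> z \<notin> insert b A)"
          using K(1) insert.hyps by blast
        then show ?thesis using K(2,3) True by blast
      next
        case False
        then have "a \<in> A" using that by simp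
        from bspec[OF A(2) this] obtain J where "J \<subseteq> W" "homogeneous Q J" "card J = k" "a \<in> J"
          "\<forall>z\<in>J. z \<noteq> a \<longrightarrow> a < z \<and> z \<notin> A" by blast
        then show ?thesis using b by (intro exI[of _ J]) blast
      qed
      moreover have "insert b W - insert b A = W - A" using b by blast
      ultimately show ?thesis using A(1,3) by (intro exI[of _ "insert b A"]) auto
    next
      case False
      have "card K \<noteq> k" if K: "K \<subseteq> insert b W - A" "homogeneous Q K" for K
      proof (cases "b \<in> K")
        case True
        then have "insert b (K - {b}) = K" "K - {b} \<subseteq> W - A" using K(1) by blast+
        then show ?thesis using False K by metis
      next
        case False
        then show ?thesis using A(3) K by blast
      qed
      moreover have "\<exists>K\<subseteq>insert b W. homogeneous Q K \<and> card K = k \<and> a \<in> K \<and>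
          (\<forall>z\<in>K. z \<noteq> a \<longrightarrow> a < z \<and> z \<notin> A)" if "a \<in> A" for a
        using bspec[OF A(2) that] by blast
      ultimately show ?thesis using A(1) by (intro exI[of _ A]) auto
    qed
  qed
  then show thesis by (elim exE conjE) (rule that; blast)
qed

text \<open>Read \<open>Q a b c\<close> as: the point b lies below the segment from a to c.\<close>

locale signotope =
  fixes V :: "'a::linorder set" and Q :: "'a \<Rightarrow> 'a \<Rightarrow> 'a \<Rightarrow> bool"
  assumes finite_V: "finite V"
    and monotone_outer: "\<lbrakk>a \<in> V; b \<in> V; c \<in> V; d \<in> V; a < b; b < c; c < d; Q a b c \<longleftrightarrow> Q b c d\<rbrakk>
      \<Longrightarrow> (Q a b d \<longleftrightarrow> Q a b c) \<and> (Q a c d \<longleftrightarrow> Q a b c)"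
    and monotone_left: "\<lbrakk>a \<in> V; b \<in> V; c \<in> V; d \<in> V; a < b; b < c; c < d; Q a b c \<longleftrightarrow> Q a c d\<rbrakk>
      \<Longrightarrow> Q a b d \<longleftrightarrow> Q a b c"
begin

abbreviation cup :: "'a set \<Rightarrow> bool" where "cup \<equiv> homogeneous Q"
abbreviation cap :: "'a set \<Rightarrow> bool" where "cap \<equiv> homogeneous (\<lambda>a b c. \<not> Q a b c)"

text \<open>The axioms only compare truth values, so negating \<open>Q\<close> preserves them. Every
  fact about cups thereby yields one about caps.\<close>

lemma dual: "signotope V (\<lambda>a b c. \<not> Q a b c)"
proof
  fix a b c d assume *: "a \<in> V" "b \<in> V" "c \<in> V" "d \<in> V" "a < b" "b < c" "c < d"
  show "(\<not> Q a b d \<longleftrightarrow> \<not> Q a b c) \<and> (\<not> Q a c d \<longleftrightarrow> \<not> Q a b c)" if "\<not> Q a b c \<longleftrightarrow> \<not> Q b c d"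
    using monotone_outer[OF *] that by blast
  show "\<not> Q a b d \<longleftrightarrow> \<not> Q a b c" if "\<not> Q a b c \<longleftrightarrow> \<not> Q a c d"
    using monotone_left[OF *] that by blast
qed (fact finite_V)

section \<open>Extending cups and caps by one point\<close>

text \<open>Checking the last edge suffices: \<open>Q z a b\<close> and \<open>Q a b c\<close> give
  \<open>Q z b c\<close>, and then \<open>Q z w b\<close> and \<open>Q w b c\<close> give
  \<open>Q z w c\<close>.\<close>

lemma cup_extend_right:
  assumes K: "K \<subseteq> V" "cup K" and "a \<in> K" "b \<in> K" "c \<in> V" "a < b" "b < c"
    and last: "\<And>z. z \<in> K \<Longrightarrow> z \<le> a \<or> z = b" and Q: "Q a b c"
  shows "cup (insert c K)"
proof -
  have b: "Q z b c" if "z \<in> K" "z < b" for z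
  proof (cases "z = a")
    case False
    then have "z < a" using last[of z] that by auto
    then show ?thesis
      using monotone_outer[of z a b c] homogeneousD[OF K(2), of z a b] assms that by auto
  qed (use Q in simp)
  have *: "Q z w c" if "z \<in> K" "w \<in> K" "z < w" for z w
  proof (cases "w = b")
    case True
    then show ?thesis using b that by simp
  next
    case False
    then have "w < b" using last[OF that(2)] assms by auto
    then show ?thesis
      using monotone_outer[of z w b c] homogeneousD[OF K(2), of z w b] b[of w] assms that by auto
  qed
  have le: "z < c" if "z \<in> K" for z using last[OF that] assms by auto
  show ?thesis
    using K(2) * le unfolding homogeneous_def by (metis insert_iff less_asym less_irrefl)
qed

lemma cup_extend_left:
  assumes K: "K \<subseteq> V" "cup K" and "a \<in> K" "b \<in> K" "c \<in> V" "b < a" "c < b"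
    and first: "\<And>z. z \<in> K \<Longrightarrow> a \<le> z \<or> z = b" and Q: "Q c b a"
  shows "cup (insert c K)"
proof -
  have b: "Q c b z" if "z \<in> K" "b < z" for z
  proof (cases "z = a")
    case False
    then have "a < z" using first[of z] that by auto
    then show ?thesis
      using monotone_outer[of c b a z] homogeneousD[OF K(2), of b a z] assms that by auto
  qed (use Q in simp)
  have *: "Q c w z" if "z \<in> K" "w \<in> K" "w < z" for z w
  proof (cases "w = b")
    case True
    then show ?thesis using b that by simp
  next
    case False
    then have "b < w" using first[OF that(2)] assms by auto
    then show ?thesis
      using monotone_outer[of c b w z] homogeneousD[OF K(2), of b w z] b[of w] assms that by auto
  qed
  have le: "c < z" if "z \<in> K" for z using first[OF that] assms by auto
  show ?thesis
    using K(2) * le unfolding homogeneous_def by (metis insert_iff less_asym less_irrefl)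
qed

lemmas cap_extend_right = signotope.cup_extend_right[OF dual]
lemmas cap_extend_left = signotope.cup_extend_left[OF dual]

text \<open>Where a cup ends and a cap begins at \<open>p\<close>, the last edge of the cup and the
  first edge of the cap form a triple with middle point \<open>p\<close>. Its sign decides which of
  the two can be extended.\<close>

lemma cup_then_cap:
  assumes "K \<subseteq> V" "L \<subseteq> V" "cup K" "cap L" "2 \<le> card K" "2 \<le> card L" "p \<in> K" "p \<in> L"
    and "\<And>z. z \<in> K \<Longrightarrow> z \<le> p" and "\<And>z. z \<in> L \<Longrightarrow> p \<le> z"
  shows "(\<exists>v\<in>L. p < v \<and> cup (insert v K)) \<or> (\<exists>u\<in>K. u < p \<and> cap (insert u L))"
proof -
  have fin: "finite K" "finite L" using assms(1,2) finite_V finite_subset by auto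
  obtain u where u: "u \<in> K" "u < p" "\<And>z. z \<in> K \<Longrightarrow> z \<le> u \<or> z = p"
    using ex_predecessor_of_greatest[OF fin(1) assms(5,7,9)] by blast
  obtain v where v: "v \<in> L" "p < v" "\<And>z. z \<in> L \<Longrightarrow> v \<le> z \<or> z = p"
    using ex_successor_of_least[OF fin(2) assms(6,8,10)] by blast
  show ?thesis
  proof (cases "Q u p v")
    case True
    then show ?thesis
      using cup_extend_right[OF assms(1,3) u(1) assms(7) _ u(2) v(2) u(3)] v assms(2) by blast
  next
    case False
    then show ?thesis
      using cap_extend_left[OF assms(2,4) v(1) assms(8) _ v(2) u(2) v(3)] u assms(1) by blast
  qed
qed

lemma cap_then_cup:
  assumes "K \<subseteq> V" "L \<subseteq> V" "cap K" "cup L" "2 \<le> card K" "2 \<le> card L" "p \<in> K" "p \<in> L"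
    and "\<And>z. z \<in> K \<Longrightarrow> z \<le> p" and "\<And>z. z \<in> L \<Longrightarrow> p \<le> z"
  shows "(\<exists>v\<in>L. p < v \<and> cap (insert v K)) \<or> (\<exists>u\<in>K. u < p \<and> cup (insert u L))"
  using signotope.cup_then_cap[OF dual assms(1,2,3) _ assms(5-10)] assms(4) by simp

section \<open>The Erdos-Szekeres bound for cups and caps\<close>

text \<open>The shift by 2 puts the trivial case, two points, at index 0 and turns the recursion
  into Pascal's rule.\<close>

theorem erdos_szekeres_cups_caps:
  assumes "X \<subseteq> V"
    and "\<And>K. K \<subseteq> X \<Longrightarrow> cup K \<Longrightarrow> card K \<noteq> i + 2"
    and "\<And>K. K \<subseteq> X \<Longrightarrow> cap K \<Longrightarrow> card K \<noteq> j + 2"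
  shows "card X \<le> (i + j) choose i"
  using assms
proof (induction "i + j" arbitrary: i j X rule: less_induct)
  case less
  have fin: "finite X" using less.prems(1) finite_V finite_subset by blast
  show ?case
  proof (cases "i = 0 \<or> j = 0")
    case True
    have "card X \<le> 1"
    proof (rule ccontr)
      assume "\<not> card X \<le> 1"
      then have "2 \<le> card X" by simp
      then obtain K where K: "K \<subseteq> X" "card K = 2" by (meson obtain_subset_with_card_n)
      then obtain a b where "K = {a, b}" by (meson card_2_iff)
      then have "homogeneous P K" for P unfolding homogeneous_def by (auto dest: less_asym)
      then show False using True less.prems(2)[of K] less.prems(3)[of K] K by auto
    qed
    then show ?thesis using True by auto
  next
    case False
    then obtain i' j' where ij: "i = Suc i'" "j = Suc j'" by (meson not0_implies_Suc)
    \<comment> \<open>\<open>A\<close> holds the right end points of the cups with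
      \<open>i + 1\<close> points. Removing it leaves no such cup. Within \<open>A\<close>, a cap
      with \<open>j + 1\<close> points would start where such a cup ends, so one of the two could be
      extended to a forbidden size.\<close>
    define A where "A = {p \<in> X. \<exists>K\<subseteq>X. cup K \<and> card K = i' + 2 \<and> p \<in> K \<and> (\<forall>z\<in>K. z \<le> p)}"
    have 1: "card (X - A) \<le> (i' + j) choose i'"
    proof (rule less.hyps)
      show "i' + j < i + j" "X - A \<subseteq> V" using ij less.prems(1) by auto
      show "card K \<noteq> i' + 2" if K: "K \<subseteq> X - A" "cup K" for K
      proof
        assume c: "card K = i' + 2"
        then have "finite K" "K \<noteq> {}" using card_ge_0_finite by force+
        then have M: "Max K \<in> K" "\<forall>z\<in>K. z \<le> Max K" by simp_all
        moreover have "K \<subseteq> X" using K(1) by blast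
        ultimately have "Max K \<in> A" unfolding A_def using K(2) c by blast
        then show False using K(1) M(1) by blast
      qed
      show "card K \<noteq> j + 2" if "K \<subseteq> X - A" "cap K" for K
        using less.prems(3) that by blast
    qed
    have 2: "card A \<le> (i + j') choose i"
    proof (rule less.hyps)
      show "i + j' < i + j" "A \<subseteq> V" using ij less.prems(1) unfolding A_def by auto
      show "card K \<noteq> i + 2" if "K \<subseteq> A" "cup K" for K
        using less.prems(2)[of K] that unfolding A_def by blast
      show "card L \<noteq> j' + 2" if L: "L \<subseteq> A" "cap L" for L
      proof
        assume c: "card L = j' + 2"
        then have finL: "finite L" "L \<noteq> {}" using card_ge_0_finite by force+
        define p where "p = Min L"
        have p: "p \<in> L" "\<And>z. z \<in> L \<Longrightarrow> p \<le> z" using finL unfolding p_def by auto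
        then have "p \<in> A" using L by blast
        then obtain K where K: "K \<subseteq> X" "cup K" "card K = i' + 2" "p \<in> K" "\<And>z. z \<in> K \<Longrightarrow> z \<le> p"
          unfolding A_def by blast
        have LX: "L \<subseteq> X" using L unfolding A_def by blast
        have "finite K" using K(1) fin finite_subset by blast
        have "K \<subseteq> V" "L \<subseteq> V" using K(1) LX less.prems(1) by auto
        moreover have "2 \<le> card K" "2 \<le> card L" using K(3) c by auto
        ultimately consider v where "v \<in> L" "p < v" "cup (insert v K)"
          | u where "u \<in> K" "u < p" "cap (insert u L)"
          using cup_then_cap[OF _ _ K(2) L(2) _ _ K(4) p(1) K(5) p(2)] by blast
        then show False
        proof cases
          case 1
          then have "v \<notin> K" using K(5)[of v] by auto
          then show False
            using less.prems(2)[of "insert v K"] 1 K(1,3) LX ij \<open>finite K\<close> by auto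
        next
          case 2
          then have "u \<notin> L" using p(2)[of u] by auto
          then show False
            using less.prems(3)[of "insert u L"] 2 K(1) LX ij c finL by auto
        qed
      qed
    qed
    have "card X \<le> card (X - A) + card A"
      using card_Un_le[of "X - A" A] card_mono[of "X - A \<union> A" X] fin
      unfolding A_def by (simp add: finite_subset)
    also have "\<dots> \<le> (i + j) choose i"
      using 1 2 ij by simp
    finally show ?thesis .
  qed
qed

section \<open>The bound when covered cups are excluded as well\<close>

lemma card_insert_in_V:
  assumes "K \<subseteq> V" "v \<notin> K"
  shows "card (insert v K) = Suc (card K)"
  using assms finite_V by (meson card_insert_disjoint finite_subset)

text \<open>With \<open>n = q + 6\<close>, the cups-caps bound is applied to three pieces:
  \<open>V - A\<close> without (n-1)-cups and (n-1)-caps, \<open>A - B\<close> without (n-1)-cups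
  and (n-2)-caps, and \<open>B\<close> without n-cups and (n-4)-caps.\<close>

lemma card_le_without_cups_caps_and_covered_cups:
  assumes no_cup: "\<And>K. K \<subseteq> V \<Longrightarrow> cup K \<Longrightarrow> card K \<noteq> q + 6"
    and no_cap: "\<And>K. K \<subseteq> V \<Longrightarrow> cap K \<Longrightarrow> card K \<noteq> q + 5"
    and no_covered_cup: "\<And>K l r v. \<lbrakk>K \<subseteq> V; cup K; card K = q + 5; l \<in> K; r \<in> K;
        \<forall>z\<in>K. l \<le> z \<and> z \<le> r; v \<in> V; l < v; v < r\<rbrakk> \<Longrightarrow> Q l v r"
  shows "card V \<le> ((2*q + 6) choose (q + 3)) + ((2*q + 5) choose (q + 3)) + ((2*q + 4) choose (q + 4))"
proof -
  obtain A where A: "A \<subseteq> V"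
    "\<And>a. a \<in> A \<Longrightarrow> \<exists>K\<subseteq>V. cup K \<and> card K = q + 5 \<and> a \<in> K \<and> (\<forall>z\<in>K. z \<noteq> a \<longrightarrow> a < z \<and> z \<notin> A)"
    "\<And>K. K \<subseteq> V - A \<Longrightarrow> cup K \<Longrightarrow> card K \<noteq> q + 5"
    using ex_greedy_hitting_set[OF finite_V, of "q + 5" Q] by (metis add_gr_0 zero_less_numeral)
  define B where "B = {p \<in> A. \<exists>K\<subseteq>A. cup K \<and> card K = q + 5 \<and> p \<in> K \<and> (\<forall>z\<in>K. z \<le> p)}"
  have BA: "B \<subseteq> A" unfolding B_def by blast
  have fin: "finite K" if "K \<subseteq> V" for K using that finite_V finite_subset by blast
  \<comment> \<open>The last point of \<open>L\<close> lies in \<open>A\<close> and so starts a cup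
    of \<open>q + 5\<close> points. That cup cannot grow to the left, so the cap grows to the
    right.\<close>
  have extend_cap: "\<exists>v\<in>V. Max L < v \<and> cap (insert v L)"
    if L: "L \<subseteq> A" "cap L" "2 \<le> card L" for L
  proof -
    have LV: "L \<subseteq> V" using L(1) A(1) by blast
    have "L \<noteq> {}" using L(3) by auto
    then have M: "Max L \<in> L" "\<And>z. z \<in> L \<Longrightarrow> z \<le> Max L" using fin[OF LV] by simp_all
    then have "Max L \<in> A" using L(1) by blast
    from A(2)[OF this] obtain K where K: "K \<subseteq> V" "cup K" "card K = q + 5" "Max L \<in> K"
      "\<forall>z\<in>K. z \<noteq> Max L \<longrightarrow> Max L < z" by blast
    have K5: "Max L \<le> z" if "z \<in> K" for z using K(5) that by force
    have "\<not> cup (insert u K)" if "u \<in> L" "u < Max L" for u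
    proof -
      have "u \<notin> K" using K5[of u] that by auto
      then have "card (insert u K) = q + 6" using card_insert_in_V[OF K(1)] K(3) by simp
      moreover have "insert u K \<subseteq> V" using K(1) LV that by blast
      ultimately show ?thesis using no_cup by blast
    qed
    then show ?thesis
      using cap_then_cup[OF LV K(1) L(2) K(2) L(3) _ M(1) K(4) M(2) K5] K(1,3) by fastforce
  qed
  have no_cap_A: "card L \<noteq> q + 4" if L: "L \<subseteq> A" "cap L" for L
  proof
    assume c: "card L = q + 4"
    have LV: "L \<subseteq> V" using L(1) A(1) by blast
    from extend_cap[OF L] c obtain v where v: "v \<in> V" "Max L < v" "cap (insert v L)" by auto
    then have "v \<notin> L" using Max_ge[OF fin[OF LV]] by force
    then show False using no_cap[of "insert v L"] card_insert_in_V[OF LV] v LV c by simp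
  qed
  have no_cap_B: "card L \<noteq> q + 2" if L: "L \<subseteq> B" "cap L" for L
  proof
    assume c: "card L = q + 2"
    have LA: "L \<subseteq> A" and LV: "L \<subseteq> V" using L(1) BA A(1) by blast+
    have "L \<noteq> {}" using c by auto
    define b1 where "b1 = Min L"
    have b1: "b1 \<in> L" "\<And>z. z \<in> L \<Longrightarrow> b1 \<le> z"
      using fin[OF LV] \<open>L \<noteq> {}\<close> unfolding b1_def by auto
    obtain b2 where b2: "b2 \<in> L" "b1 < b2" "\<And>z. z \<in> L \<Longrightarrow> b2 \<le> z \<or> z = b1"
      using ex_successor_of_least[OF fin[OF LV] _ b1] c by auto
    from extend_cap[OF LA L(2)] c obtain v where v: "v \<in> V" "Max L < v" "cap (insert v L)" by auto
    have vL: "z < v" if "z \<in> L" for z using v(2) Max_ge[OF fin[OF LV] that] by simp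
    have vcard: "card (insert v L) = q + 3"
      using card_insert_in_V[OF LV, of v] vL c by fastforce
    define L' where "L' = insert v L"
    have L': "L' \<subseteq> V" "cap L'" "b1 \<in> L'" "b2 \<in> L'" "card L' = q + 3"
        "\<And>z. z \<in> L' \<Longrightarrow> b2 \<le> z \<or> z = b1"
      using v LV b1 b2 vcard vL[OF b2(1)]
      unfolding L'_def by (auto intro: less_imp_le)
    have bV: "b1 \<in> V" "b2 \<in> V" using L'(1,3,4) by auto
    \<comment> \<open>\<open>L'\<close> is only two points short of a forbidden cap, so
      \<open>s\<close> and \<open>r\<close> cannot both continue it to the left.\<close>
    have no_double_extension: "Q s r b1" if "s \<in> V" "r \<in> V" "s < r" "r < b1" "\<not> Q r b1 b2" for s r
    proof (rule ccontr)
      assume neg: "\<not> Q s r b1"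
      have 1: "cap (insert r L')"
        using cap_extend_left[OF L'(1,2,4,3) that(2) b2(2) that(4) L'(6) that(5)] .
      have ge: "z \<ge> b1" if "z \<in> L'" for z using L'(6)[OF that] b2(2) by auto
      have "cap (insert s (insert r L'))"
        by (rule cap_extend_left[OF _ 1, of b1 r]) (use that L' ge neg in auto)
      moreover have "r \<notin> L'" "s \<notin> insert r L'" using ge that by force+
      then have "card (insert s (insert r L')) = q + 5"
        using card_insert_in_V[of L' r] card_insert_in_V[of "insert r L'" s] L'(1,5) that by simp
      ultimately show False using no_cap[of "insert s (insert r L')"] L'(1) that by blast
    qed
    have "b1 \<in> B" using b1(1) L(1) by blast
    then obtain T where T: "T \<subseteq> A" "cup T" "card T = q + 5" "b1 \<in> T" "\<And>z. z \<in> T \<Longrightarrow> z \<le> b1"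
      unfolding B_def by blast
    have b1A: "b1 \<in> A" using \<open>b1 \<in> B\<close> BA by blast
    have TV: "T \<subseteq> V" using T(1) A(1) by blast
    obtain y where y: "y \<in> T" "y < b1" "\<And>z. z \<in> T \<Longrightarrow> z \<le> y \<or> z = b1"
      using ex_predecessor_of_greatest[OF fin[OF TV] _ T(4,5)] T(3) by auto
    define T0 where "T0 = T - {b1}"
    have T0: "T0 \<subseteq> V" "cup T0" "card T0 = q + 4" "y \<in> T0" "\<And>z. z \<in> T0 \<Longrightarrow> z \<le> y"
      using T y TV fin[OF TV] homogeneous_subset[OF T(2), of T0] unfolding T0_def by auto
    obtain u where u: "u \<in> T0" "u < y" "\<And>z. z \<in> T0 \<Longrightarrow> z \<le> u \<or> z = y"
      using ex_predecessor_of_greatest[OF fin[OF T0(1)] _ T0(4,5)] T0(3) by auto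
    have yV: "y \<in> V" and uV: "u \<in> V" using T0 u by auto
    \<comment> \<open>\<open>T\<close> already has \<open>q + 5\<close> points, so no point to the
      right of \<open>b1\<close> may continue its last edge.\<close>
    have T_maximal: "\<not> Q y b1 w" if "w \<in> V" "b1 < w" for w
    proof
      assume "Q y b1 w"
      then have "cup (insert w T)"
        using cup_extend_right[OF TV T(2) y(1) T(4) that(1) y(2) that(2) y(3)] by blast
      moreover have "w \<notin> T" using T(5)[of w] that by auto
      ultimately show False
        using no_cup[of "insert w T"] card_insert_in_V[OF TV] T(3) TV that by simp
    qed
    have "y \<in> A" using y(1) T(1) by blast
    from A(2)[OF this] obtain K where K: "K \<subseteq> V" "cup K" "card K = q + 5" "y \<in> K"
      "\<forall>z\<in>K. z \<noteq> y \<longrightarrow> y < z \<and> z \<notin> A" by blast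
    have K_ge: "y \<le> z" if "z \<in> K" for z using K(5) that by force
    have "K \<noteq> {}" using K(4) by blast
    define r where "r = Max K"
    have r: "r \<in> K" "\<And>z. z \<in> K \<Longrightarrow> z \<le> r"
      using fin[OF K(1)] \<open>K \<noteq> {}\<close> unfolding r_def by auto
    obtain r1 where r1: "r1 \<in> K" "r1 < r" "\<And>z. z \<in> K \<Longrightarrow> z \<le> r1 \<or> z = r"
      using ex_predecessor_of_greatest[OF fin[OF K(1)] _ r] K(3) by auto
    define K0 where "K0 = K - {r}"
    have K0: "K0 \<subseteq> V" "cup K0" "card K0 = q + 4" "r1 \<in> K0" "\<And>z. z \<in> K0 \<Longrightarrow> z \<le> r1"
      using K r r1 fin[OF K(1)] homogeneous_subset[OF K(2), of K0] unfolding K0_def by auto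
    obtain r2 where r2: "r2 \<in> K0" "r2 < r1" "\<And>z. z \<in> K0 \<Longrightarrow> z \<le> r2 \<or> z = r1"
      using ex_predecessor_of_greatest[OF fin[OF K0(1)] _ K0(4,5)] K0(3) by auto
    have rV: "r \<in> V" "r1 \<in> V" "r2 \<in> V" using K0 r2 r K(1) by auto
    have r2K: "r2 \<in> K" using r2(1) unfolding K0_def by blast
    have yr1: "y < r1" using K_ge[OF r2K] r2(2) by simp
    have yr: "y < r" using yr1 r1(2) by simp
    \<comment> \<open>The greedy choice enters here: \<open>K\<close> meets \<open>A\<close> only in
      \<open>y\<close>, whereas \<open>b1\<close> belongs to \<open>A\<close>.\<close>
    have "r \<noteq> b1" using K(5) r(1) yr b1A by auto
    then consider "b1 < r" | "r < b1" by force
    then show False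
    proof cases
      case 1
      then have "Q y b1 r"
        using no_covered_cup[OF K(1-4) r(1) _ bV(1) y(2)] K_ge r(2) by blast
      then show False using T_maximal[OF rV(1) 1] by blast
    next
      case 2
      have nQ: "\<not> Q y b1 b2" using T_maximal[OF bV(2) b2(2)] .
      have "\<not> Q r1 r b1"
      proof
        assume "Q r1 r b1"
        then have "cup (insert b1 K)"
          using cup_extend_right[OF K(1,2) r1(1) r(1) bV(1) r1(2) 2 r1(3)] by blast
        moreover have "b1 \<notin> K" using r(2)[of b1] 2 by auto
        ultimately show False
          using no_cup[of "insert b1 K"] card_insert_in_V[OF K(1)] K(1,3) bV by simp
      qed
      then have Qr: "Q r b1 b2" using no_double_extension[OF rV(2,1) r1(2) 2] by blast
      \<comment> \<open>If \<open>Q y r b1\<close> held, then with \<open>Q r b1 b2\<close> it would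
        give \<open>Q y b1 b2\<close>, against the maximality of \<open>T\<close>.\<close>
      have nQr: "\<not> Q y r b1"
        using monotone_outer[OF yV rV(1) bV yr 2 b2(2)] Qr nQ by blast
      have r1b1: "r1 < b1" using r1(2) 2 by simp
      show False
      proof (cases "Q r1 b1 b2")
        \<comment> \<open>Now \<open>b1\<close> can replace \<open>r\<close>: \<open>K0\<close> with
          \<open>b1\<close> is a cup of \<open>q + 5\<close> points from \<open>y\<close> to
          \<open>b1\<close>. As \<open>r\<close> lies between these ends, the hypothesis on covered
          cups contradicts \<open>nQr\<close>.\<close>
        case False
        have "Q r2 r1 b1" using no_double_extension[OF rV(3,2) r2(2) r1b1 False] .
        then have "cup (insert b1 K0)"
          using cup_extend_right[OF K0(1,2) r2(1) K0(4) bV(1) r2(2) r1b1 r2(3)] by blast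
        moreover have "b1 \<notin> K0" using K0(5)[of b1] r1b1 by auto
        moreover have "y \<in> K0" using K(4) yr unfolding K0_def by simp
        moreover have "\<forall>z\<in>insert b1 K0. y \<le> z \<and> z \<le> b1"
          using K0(5) r1b1 K_ge y(2) unfolding K0_def by fastforce
        ultimately have "Q y r b1"
          using no_covered_cup[of "insert b1 K0" y b1 r] card_insert_in_V[OF K0(1)] K0(1,3) bV rV yr 2
          by simp
        then show False using nQr by blast
      next
        \<comment> \<open>If \<open>Q u y r1\<close> failed, then together with the failure of
          \<open>Q y r1 b1\<close> it would make \<open>Q u y b1\<close> fail, although
          \<open>T\<close> is a cup. Hence the \<open>q + 4\<close> points of \<open>T0\<close>
          extend by \<open>r1\<close> and then by \<open>r\<close>.\<close>
        case True
        have "\<not> Q y r1 b1"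
          using monotone_outer[OF yV rV(2) bV yr1 r1b1 b2(2)] True nQ by blast
        moreover have "Q u y b1"
          using homogeneousD[OF T(2)] u(1,2) y(1,2) T(4) unfolding T0_def by blast
        ultimately have "Q u y r1"
          using monotone_outer[OF uV yV rV(2) bV(1) u(2) yr1 r1b1] by blast
        then have c1: "cup (insert r1 T0)"
          using cup_extend_right[OF T0(1,2) u(1) T0(4) rV(2) u(2) yr1 u(3)] by blast
        have "Q y r1 r" using homogeneousD[OF K(2,4) r1(1) r(1) yr1 r1(2)] .
        then have "cup (insert r (insert r1 T0))"
          by (intro cup_extend_right[OF _ c1, of y r1 r]) (use T0 rV yr1 r1 in auto)
        moreover have "r1 \<notin> T0" "r \<notin> insert r1 T0" using T0(5) yr1 r1(2) yr by force+
        then have "card (insert r (insert r1 T0)) = q + 6"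
          using card_insert_in_V[OF T0(1)] card_insert_in_V[of "insert r1 T0" r] T0(1,3) rV by simp
        ultimately show False using no_cup[of "insert r (insert r1 T0)"] T0(1) rV by blast
      qed
    qed
  qed
  have VA: "card (V - A) \<le> (2*q + 6) choose (q + 3)"
  proof -
    have "card (V - A) \<le> ((q + 3) + (q + 3)) choose (q + 3)"
    proof (rule erdos_szekeres_cups_caps)
      show "card K \<noteq> q + 3 + 2" if "K \<subseteq> V - A" "cup K" for K
        using A(3)[OF that] by simp
      show "card K \<noteq> q + 3 + 2" if "K \<subseteq> V - A" "cap K" for K
        using no_cap[OF _ that(2)] that(1) by (simp add: subset_iff)
    qed blast
    moreover have "(q + 3) + (q + 3) = 2*q + 6" by simp
    ultimately show ?thesis by (simp only:)
  qed
  have AB: "card (A - B) \<le> (2*q + 5) choose (q + 3)"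
  proof -
    have "card (A - B) \<le> ((q + 3) + (q + 2)) choose (q + 3)"
    proof (rule erdos_szekeres_cups_caps)
      show "A - B \<subseteq> V" using A(1) by blast
      show "card K \<noteq> q + 3 + 2" if K: "K \<subseteq> A - B" "cup K" for K
      proof
        assume c: "card K = q + 3 + 2"
        then have c': "card K = q + 5" by simp
        have "finite K" "K \<noteq> {}" using fin[of K] K(1) A(1) c by auto
        then have M: "Max K \<in> K" "\<forall>z\<in>K. z \<le> Max K" by simp_all
        moreover have "K \<subseteq> A" using K(1) by blast
        ultimately have "Max K \<in> B" unfolding B_def using K(2) c' by blast
        then show False using K(1) M(1) by blast
      qed
      show "card K \<noteq> q + 2 + 2" if "K \<subseteq> A - B" "cap K" for K
        using no_cap_A[OF _ that(2)] that(1) by (simp add: subset_iff)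
    qed
    moreover have "(q + 3) + (q + 2) = 2*q + 5" by simp
    ultimately show ?thesis by (simp only:)
  qed
  have "card B \<le> ((q + 4) + q) choose (q + 4)"
  proof (rule erdos_szekeres_cups_caps)
    show "B \<subseteq> V" using A(1) BA by blast
    show "card K \<noteq> q + 4 + 2" if "K \<subseteq> B" "cup K" for K
      using no_cup[OF _ that(2)] that(1) A(1) BA by (simp add: subset_iff)
  qed (use no_cap_B in blast)
  moreover have "(q + 4) + q = 2*q + 4" by simp
  ultimately have B: "card B \<le> (2*q + 4) choose (q + 4)" by (simp only:)
  have "V = (V - A) \<union> (A - B) \<union> B" using A(1) BA by blast
  then have "card V \<le> card (V - A) + card (A - B) + card B"
    using card_Un_le[of "(V - A) \<union> (A - B)" B] card_Un_le[of "V - A" "A - B"] by simp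
  then show ?thesis using VA AB B by linarith
qed

section \<open>A cup together with a point above its chord\<close>

text \<open>One sign, that of \<open>v\<close> against the chord from \<open>l\<close> to
  \<open>r\<close>, determines all triples containing \<open>v\<close>. They are those of a convex
  polygon with lower chain \<open>K\<close> and \<open>v\<close> as its only vertex above the
  chord.\<close>

lemma covered_cup:
  assumes K: "K \<subseteq> V" "cup K" and "l \<in> K" "r \<in> K" and bounds: "\<And>z. z \<in> K \<Longrightarrow> l \<le> z \<and> z \<le> r"
    and v: "v \<in> V" "l < v" "v < r" "\<not> Q l v r"
    and zw: "z \<in> K" "w \<in> K" "z < w"
  shows "w < v \<Longrightarrow> Q z w v" and "z < v \<Longrightarrow> v < w \<Longrightarrow> \<not> Q z v w" and "v < z \<Longrightarrow> Q v z w"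
proof -
  have V: "l \<in> V" "r \<in> V" "z \<in> V" "w \<in> V" using assms by auto
  \<comment> \<open>The chord is first shortened at one end: \<open>v\<close> stays above the
    segment from \<open>p\<close> to \<open>r\<close>, and symmetrically above the one from
    \<open>l\<close> to \<open>p\<close>. The three claims then follow from the axioms.\<close>
  have left: "\<not> Q p v r" if p: "p \<in> K" "p < v" for p
  proof (cases "p = l")
    case False
    then have "l < p" using bounds[OF p(1)] by auto
    moreover have "Q l p r" using homogeneousD[OF K(2) \<open>l \<in> K\<close> p(1) \<open>r \<in> K\<close>] \<open>l < p\<close> p v by auto
    ultimately show ?thesis
      using monotone_outer[of l p v r] monotone_left[of l p v r] p v V K(1) by blast
  qed (use v in simp)
  have right: "\<not> Q l v p" if p: "p \<in> K" "v < p" for p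
  proof (cases "p = r")
    case False
    then have "p < r" using bounds[OF p(1)] by auto
    moreover have "Q l p r" using homogeneousD[OF K(2) \<open>l \<in> K\<close> p(1) \<open>r \<in> K\<close>] \<open>p < r\<close> p v by auto
    ultimately show ?thesis
      using monotone_left[of l v p r] p v V K(1) by blast
  qed (use v in simp)
  show "Q z w v" if "w < v"
  proof -
    have "Q z w r" using homogeneousD[OF K(2) zw(1,2) \<open>r \<in> K\<close> zw(3)] that v by simp
    then show ?thesis
      using monotone_outer[OF V(3,4) v(1) V(2) zw(3) that v(3)] left[OF zw(2) that] by blast
  qed
  show "\<not> Q z v w" if zvw: "z < v" "v < w"
  proof (cases "w = r")
    case False
    then have "w < r" using bounds[OF zw(2)] by auto
    then have "Q z w r" using homogeneousD[OF K(2) zw(1,2) \<open>r \<in> K\<close> zw(3)] by simp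
    then show ?thesis
      using monotone_left[OF V(3) v(1) V(4,2) zvw \<open>w < r\<close>] left[OF zw(1) zvw(1)] by blast
  qed (use left zw zvw in blast)
  show "Q v z w" if "v < z"
  proof -
    have "Q l z w" using homogeneousD[OF K(2) \<open>l \<in> K\<close> zw(1,2) _ zw(3)] that v by simp
    then show ?thesis
      using monotone_outer[OF V(1) v(1) V(3,4) v(2) that zw(3)] right[OF zw(1) that] by blast
  qed
qed

end

section \<open>Orientation of planar triples\<close>

text \<open>Twice the signed area of the triangle, positive for a counterclockwise triple.\<close>

definition orient :: "real^2 \<Rightarrow> real^2 \<Rightarrow> real^2 \<Rightarrow> real" where
  "orient a b c = (b$1 - a$1) * (c$2 - a$2) - (b$2 - a$2) * (c$1 - a$1)"

lemma orient_rotate: "orient b c a = orient a b c"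
  unfolding orient_def by algebra

lemma orient_reverse: "orient c b a = - orient a b c"
  unfolding orient_def by algebra

lemma orient_swap: "orient a c b = - orient a b c"
  unfolding orient_def by algebra

lemma orient_refl [simp]: "orient a a b = 0" "orient a b a = 0" "orient a b b = 0"
  unfolding orient_def by simp_all

lemma orient_affine:
  assumes "u + v = 1"
  shows "orient a b (u *\<^sub>R x + v *\<^sub>R y) = u * orient a b x + v * orient a b y"
proof -
  have u: "u = 1 - v" using assms by simp
  show ?thesis unfolding orient_def u by (simp add: algebra_simps)
qed

lemma orient_eq_0_of_collinear:
  assumes "collinear S" "a \<in> S" "b \<in> S" "c \<in> S"
  shows "orient a b c = 0"
proof -
  obtain w where w: "\<And>x y. x \<in> S \<Longrightarrow> y \<in> S \<Longrightarrow> \<exists>t. x - y = t *\<^sub>R w"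
    using assms(1) unfolding collinear_def by blast
  obtain s t where "b - a = s *\<^sub>R w" "c - a = t *\<^sub>R w" using w assms(2-4) by meson
  then have "b$1 - a$1 = s * w$1" "b$2 - a$2 = s * w$2" "c$1 - a$1 = t * w$1" "c$2 - a$2 = t * w$2"
    by (simp_all flip: vector_minus_component)
  then show ?thesis unfolding orient_def by simp
qed

lemma collinear_of_orient_eq_0:
  assumes "orient a b c = 0"
  shows "collinear {a, b, c}"
proof -
  have "collinear {0, b - a, c - a}"
  proof (cases "b = a")
    case False
    define w where "w = b - a"
    define z where "z = c - a"
    have eq: "w$1 * z$2 = w$2 * z$1" using assms unfolding orient_def w_def z_def by simp
    have "w \<noteq> 0" using False unfolding w_def by simp
    then consider "w$1 \<noteq> 0" | "w$2 \<noteq> 0" by (metis vec_eq_iff exhaust_2 zero_index)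
    then have "\<exists>t. z = t *\<^sub>R w"
    proof cases
      case 1
      then have "z = (z$1 / w$1) *\<^sub>R w"
        using eq by (simp add: vec_eq_iff forall_2 field_simps)
      then show ?thesis by blast
    next
      case 2
      then have "z = (z$2 / w$2) *\<^sub>R w"
        using eq by (simp add: vec_eq_iff forall_2 field_simps)
      then show ?thesis by blast
    qed
    then show ?thesis unfolding collinear_lemma w_def z_def by blast
  qed simp
  then have "collinear {b, a, c}" by (simp add: collinear_3)
  then show ?thesis by (simp add: insert_commute)
qed

lemma orient_neq_0:
  assumes "general_position S" "a \<in> S" "b \<in> S" "c \<in> S" "a \<noteq> b" "b \<noteq> c" "a \<noteq> c"
  shows "orient a b c \<noteq> 0"
proof
  assume "orient a b c = 0"
  then have "collinear {a, b, c}" by (rule collinear_of_orient_eq_0)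
  moreover have "card {a, b, c} = 3" "{a, b, c} \<subseteq> S" using assms by auto
  ultimately show False using assms(1) unfolding general_position_def by blast
qed

section \<open>Convex position from orientations\<close>

text \<open>The open half plane to the left of the line from \<open>v\<close> to \<open>w\<close>,
  with the single boundary point \<open>w\<close> added, is convex, contains \<open>T\<close> and
  omits \<open>v\<close>.\<close>

lemma notin_convex_hull_if_orient_pos:
  assumes "v \<noteq> w" "\<And>z. z \<in> T \<Longrightarrow> z \<noteq> w \<Longrightarrow> orient v w z > 0"
  shows "v \<notin> convex hull T"
proof -
  let ?H = "{z. z = w \<or> orient v w z > 0}"
  have "convex ?H"
  proof (rule convexI)
    fix x y :: "real^2" and s t :: real
    assume *: "x \<in> ?H" "y \<in> ?H" "0 \<le> s" "0 \<le> t" "s + t = 1"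
    have o: "orient v w (s *\<^sub>R x + t *\<^sub>R y) = s * orient v w x + t * orient v w y"
      using orient_affine[OF *(5)] .
    consider "s = 0" | "t = 0" | "s > 0" "t > 0" using * by linarith
    then show "s *\<^sub>R x + t *\<^sub>R y \<in> ?H"
    proof cases
      case 3
      have "x = w \<and> y = w \<or> orient v w x > 0 \<and> orient v w y \<ge> 0 \<or> orient v w x \<ge> 0 \<and> orient v w y > 0"
        using *(1,2) by auto
      then show ?thesis
      proof (elim disjE conjE)
        assume "x = w" "y = w"
        then show ?thesis using *(5) by (simp flip: scaleR_left_distrib)
      next
        assume "orient v w x > 0" "orient v w y \<ge> 0"
        then have "s * orient v w x + t * orient v w y > 0" using 3 by (intro add_pos_nonneg) auto
        then show ?thesis using o by simp
      next
        assume "orient v w x \<ge> 0" "orient v w y > 0"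
        then have "s * orient v w x + t * orient v w y > 0" using 3 by (intro add_nonneg_pos) auto
        then show ?thesis using o by simp
      qed
    qed (use * in auto)
  qed
  moreover have "T \<subseteq> ?H" using assms(2) by blast
  ultimately have "convex hull T \<subseteq> ?H" by (rule hull_minimal[rotated])
  moreover have "v \<notin> ?H" using assms(1) by simp
  ultimately show ?thesis by blast
qed

text \<open>\<open>f\<close> lists the points counterclockwise, and each point spans a supporting
  edge with its cyclic successor. The order type of \<open>f\<close> is arbitrary so that one extra
  point can later be put first, at minus infinity.\<close>

lemma convex_position_if_orient_pos:
  fixes f :: "real^2 \<Rightarrow> 'k::linorder"
  assumes card: "3 \<le> card T" and inj: "inj_on f T"
    and pos: "\<And>a b c. \<lbrakk>a \<in> T; b \<in> T; c \<in> T; f a < f b; f b < f c\<rbrakk> \<Longrightarrow> orient a b c > 0"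
  shows "convex_position T"
proof -
  have fin: "finite T" using card card.infinite by fastforce
  define P where "P = convex hull T"
  have indep: "v \<notin> convex hull (T - {v})" if v: "v \<in> T" for v
  proof (cases "\<exists>w\<in>T. f v < f w")
    case True
    define W where "W = {w \<in> T. f v < f w}"
    have "finite W" "W \<noteq> {}" using fin True unfolding W_def by auto
    then obtain w where w: "w \<in> W" "\<And>z. z \<in> W \<Longrightarrow> f w \<le> f z"
      by (metis arg_min_if_finite(1) arg_min_least)
    show ?thesis
    proof (rule notin_convex_hull_if_orient_pos[of v w])
      show "v \<noteq> w" using w(1) unfolding W_def by auto
      fix z assume z: "z \<in> T - {v}" "z \<noteq> w"
      then have ne: "f z \<noteq> f v" "f z \<noteq> f w" using inj v w(1) unfolding W_def inj_on_def by auto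
      show "orient v w z > 0"
      proof (cases "f v < f z")
        case True
        then have "f w < f z" using w(2)[of z] z ne unfolding W_def by auto
        then show ?thesis using pos[of v w z] v w(1) z unfolding W_def by auto
      next
        case False
        then have "f z < f v" using ne by auto
        then have "orient z v w > 0" using pos[of z v w] v w(1) z unfolding W_def by auto
        then show ?thesis using orient_rotate[of v w z] by simp
      qed
    qed
  next
    \<comment> \<open>The last point in the order wraps around: its successor is the first
      one.\<close>
    case False
    have "T \<noteq> {}" using v by blast
    then obtain w where w: "w \<in> T" "\<And>z. z \<in> T \<Longrightarrow> f w \<le> f z"
      using fin by (metis arg_min_if_finite(1) arg_min_least)
    show ?thesis
    proof (rule notin_convex_hull_if_orient_pos[of v w])
      show "v \<noteq> w"
      proof
        assume "v = w"
        then have "f z = f v" if "z \<in> T" for z using w(2) False that by force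
        then have "T \<subseteq> {v}" using inj v unfolding inj_on_def by blast
        then have "card T \<le> 1" using card_mono[of "{v}" T] by simp
        then show False using card by simp
      qed
      fix z assume z: "z \<in> T - {v}" "z \<noteq> w"
      then have ne: "f z \<noteq> f v" "f z \<noteq> f w" using inj v w(1) unfolding inj_on_def by auto
      then have "f w < f z" "f z < f v" using w(2)[of z] False z by force+
      then have "orient w z v > 0" using pos v w(1) z by auto
      then show "orient v w z > 0" using orient_rotate[of w z v] by simp
    qed
  qed
  \<comment> \<open>Any three points of \<open>T\<close> have nonzero orientation, so the hull is
    two-dimensional.\<close>
  have "\<not> collinear T"
  proof
    assume col: "collinear T"
    obtain U where U: "U \<subseteq> f ` T" "card U = 3"
      using card card_image[OF inj] by (metis obtain_subset_with_card_n)
    have "finite U" using U(2) card.infinite by fastforce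
    have "U \<noteq> {}" using U(2) by auto
    obtain p where p: "p \<in> U" "\<forall>z\<in>U. p \<le> z" using \<open>finite U\<close> \<open>U \<noteq> {}\<close> by (meson Min_in Min_le)
    have "card (U - {p}) = 2" using U(2) p(1) \<open>finite U\<close> by simp
    then obtain q r where qr: "U - {p} = {q, r}" "q < r"
      by (metis card_2_iff doubleton_eq_iff neqE)
    then have "q \<in> U - {p}" by simp
    then have "p < q" using p(2) by (metis DiffE insertI1 order_le_imp_less_or_eq)
    moreover obtain a b c where "a \<in> T" "b \<in> T" "c \<in> T" "f a = p" "f b = q" "f c = r"
      using U(1) p(1) qr(1) by (smt (verit) DiffD1 imageE insertI1 insertI2 subsetD)
    ultimately show False
      using pos[of a b c] qr(2) orient_eq_0_of_collinear[OF col, of a b c] by auto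
  qed
  then have "aff_dim P > 1" unfolding P_def by (simp add: collinear_aff_dim aff_dim_convex_hull)
  moreover have "aff_dim P \<le> 2" using aff_dim_le_DIM[of P] by simp
  ultimately have "aff_dim P = 2" by linarith
  moreover have "polytope P" unfolding P_def using fin by (auto simp: polytope_def)
  moreover have "T = {v. v extreme_point_of P}"
    unfolding P_def using extreme_point_of_convex_hull_convex_independent[of T] indep fin
    by (auto simp: finite_imp_compact)
  ultimately show ?thesis unfolding convex_position_def convex_polygon_def by blast
qed


section \<open>The signotope of points ordered around a vertex\<close>

lemma orient_triangle: "orient a b c = orient x a b + orient x b c - orient x a c"
  unfolding orient_def by (simp add: algebra_simps)

lemma orient_grassmann_pluecker:
  "orient x a b * orient x c d - orient x a c * orient x b d + orient x a d * orient x b c = 0"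
proof -
  have "(a1 * b2 - a2 * b1) * (c1 * d2 - c2 * d1) - (a1 * c2 - a2 * c1) * (b1 * d2 - b2 * d1)
      + (a1 * d2 - a2 * d1) * (b1 * c2 - b2 * c1) = 0" for a1 a2 b1 b2 c1 c2 d1 d2 :: real
    by (simp add: algebra_simps)
  then show ?thesis unfolding orient_def .
qed

text \<open>When all orientations starting at \<open>x\<close> are positive, each identity exhibits
  one triple as a positive combination of two others, so it inherits their common sign. The three
  cases are what the signotope axioms require.\<close>

lemma orient_exchange:
  "orient a b d * orient x b c = orient a b c * orient x b d + orient b c d * orient x a b"
  "orient a c d * orient x b c = orient b c d * orient x a c + orient a b c * orient x c d"
  "orient a b d * orient x a c = orient a c d * orient x a b + orient a b c * orient x a d"
proof -
  note triangle = orient_triangle[of a b d x] orient_triangle[of a b c x]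
    orient_triangle[of b c d x] orient_triangle[of a c d x]
  have rel: "orient x a b * orient x c d = orient x a c * orient x b d - orient x a d * orient x b c"
    using orient_grassmann_pluecker[of x a b c d] by linarith
  show "orient a b d * orient x b c = orient a b c * orient x b d + orient b c d * orient x a b"
    "orient a c d * orient x b c = orient b c d * orient x a c + orient a b c * orient x c d"
    "orient a b d * orient x a c = orient a c d * orient x a b + orient a b c * orient x a d"
    unfolding triangle using rel by (simp_all add: algebra_simps)
qed

text \<open>The points appear counterclockwise around \<open>x\<close>. A negative triple has its
  middle point on the side of \<open>x\<close> of the segment joining the outer two, which is the
  meaning of "below" here.\<close>

lemma signotope_around_vertex:
  assumes "finite V"
    and nonzero: "\<And>a b c. \<lbrakk>a \<in> V; b \<in> V; c \<in> V; a < b; b < c\<rbrakk> \<Longrightarrow> orient (e a) (e b) (e c) \<noteq> 0"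
    and pos: "\<And>a b. \<lbrakk>a \<in> V; b \<in> V; a < b\<rbrakk> \<Longrightarrow> orient x (e a) (e b) > 0"
  shows "signotope V (\<lambda>a b c. orient (e a) (e b) (e c) < 0)"
proof
  have sign: "s < 0 \<longleftrightarrow> t < 0"
    if "s * p = t * u + w * v" "0 < p" "0 < u" "0 < v" "t < 0 \<longleftrightarrow> w < 0" "t \<noteq> 0" "w \<noteq> 0"
    for s p t u w v :: real
  proof (cases "t < 0")
    case True
    then have "t * u + w * v < 0" using that by (simp add: add_neg_neg mult_neg_pos)
    then show ?thesis using that True by (metis mult_less_0_iff not_less_iff_gr_or_eq)
  next
    case False
    then have "t * u + w * v > 0" using that by (simp add: add_pos_pos)
    then show ?thesis using that False by (metis zero_less_mult_iff not_less_iff_gr_or_eq)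
  qed
  fix a b c d assume V: "a \<in> V" "b \<in> V" "c \<in> V" "d \<in> V" and lt: "a < b" "b < c" "c < d"
  note lt' = less_trans[OF lt(1,2)] less_trans[OF lt(2,3)]
  note ad = less_trans[OF lt(1) lt'(2)]
  note nz = nonzero[OF V(1,2,3) lt(1,2)] nonzero[OF V(2,3,4) lt(2,3)] nonzero[OF V(1,3,4) lt'(1) lt(3)]
  show "(orient (e a) (e b) (e d) < 0 \<longleftrightarrow> orient (e a) (e b) (e c) < 0) \<and>
      (orient (e a) (e c) (e d) < 0 \<longleftrightarrow> orient (e a) (e b) (e c) < 0)"
    if "orient (e a) (e b) (e c) < 0 \<longleftrightarrow> orient (e b) (e c) (e d) < 0"
    using sign[OF orient_exchange(1)[of "e a" "e b" "e d" x "e c"]]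
      sign[OF orient_exchange(2)[of "e a" "e c" "e d" x "e b"]] pos V lt lt' nz that by simp
  show "orient (e a) (e b) (e d) < 0 \<longleftrightarrow> orient (e a) (e b) (e c) < 0"
    if "orient (e a) (e b) (e c) < 0 \<longleftrightarrow> orient (e a) (e c) (e d) < 0"
    using sign[OF orient_exchange(3)[of "e a" "e b" "e d" x "e c"]] pos V lt lt' ad nz that by simp
qed (fact assms(1))


section \<open>From cups and caps to convex polygons\<close>

lemma ex_convex_position:
  assumes S: "general_position S"
    and card: "card S = ((2*q + 6) choose (q + 3)) + ((2*q + 5) choose (q + 3)) + ((2*q + 4) choose (q + 4)) + 2"
  shows "\<exists>T\<subseteq>S. card T = q + 6 \<and> convex_position T"
proof (rule ccontr)
  assume contra: "\<not> ?thesis"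
  have fin: "finite S" using S unfolding general_position_def by blast
  have "S \<noteq> {}" using card by auto
  \<comment> \<open>A point farthest from the origin is a vertex of the hull, strictly supported by \<open>g\<close>.\<close>
  then have "Max (norm ` S) \<in> norm ` S" using fin by simp
  then obtain x where "x \<in> S" "norm x = Max (norm ` S)" by auto
  then have x: "x \<in> S" "\<And>p. p \<in> S \<Longrightarrow> norm p \<le> norm x" using fin by simp_all
  define g where "g p = x \<bullet> (x - p)" for p
  \<comment> \<open>This uses that \<open>2 * g p\<close> equals the squared norm of
    \<open>x\<close>, minus that of \<open>p\<close>, plus that of \<open>x - p\<close>.\<close>
  have g: "g p > 0" if "p \<in> S - {x}" for p
  proof -
    have "norm p ^ 2 \<le> norm x ^ 2" using x(2) that by (simp add: power_mono)
    moreover have "(x - p) \<bullet> (x - p) > 0" using that by auto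
    ultimately show ?thesis
      unfolding g_def by (simp add: inner_diff inner_commute power2_norm_eq_inner)
  qed
  define h where "h p = x$2 * (p$1 - x$1) - x$1 * (p$2 - x$2)" for p :: "real^2"
  \<comment> \<open>The slope of p seen from x, in coordinates whose first axis points along -x.\<close>
  define key where "key p = h p / g p" for p
  \<comment> \<open>The map from \<open>p - x\<close> to the pair of \<open>g p\<close> and
    \<open>h p\<close> is an orientation-preserving similarity scaling lengths by the norm of
    \<open>x\<close>, hence areas by its square.\<close>
  have gh: "g p * h r - h p * g r = (x$1 ^ 2 + x$2 ^ 2) * orient x p r" for p r
    unfolding g_def h_def orient_def inner_vec_def by (simp add: sum_2 power2_eq_square algebra_simps)
  have key: "key p < key r \<longleftrightarrow> orient x p r > 0" if "p \<in> S - {x}" "r \<in> S - {x}" for p r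
  proof -
    have "x \<noteq> 0" using g[OF that(1)] unfolding g_def by auto
    then have "x$1 ^ 2 + x$2 ^ 2 > 0"
      by (metis sum_power2_gt_zero_iff vec_eq_iff exhaust_2 zero_index)
    moreover have "key p < key r \<longleftrightarrow> g p * h r - h p * g r > 0"
      using g[OF that(1)] g[OF that(2)] unfolding key_def by (simp add: field_simps)
    ultimately show ?thesis unfolding gh by (simp add: zero_less_mult_iff)
  qed
  have nonzero: "orient a b c \<noteq> 0" if "a \<in> S" "b \<in> S" "c \<in> S" "a \<noteq> b" "b \<noteq> c" "a \<noteq> c" for a b c
    using orient_neq_0[OF S that] .
  have inj: "inj_on key (S - {x})"
  proof (rule inj_onI, rule ccontr)
    fix p r assume *: "p \<in> S - {x}" "r \<in> S - {x}" "key p = key r" "p \<noteq> r"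
    then have "\<not> orient x p r > 0" "\<not> orient x r p > 0" using key[of p r] key[of r p] by auto
    moreover have "orient x r p = - orient x p r" by (rule orient_swap)
    ultimately have "orient x p r = 0" by simp
    then show False using nonzero[of x p r] * x(1) by auto
  qed
  \<comment> \<open>Signotopes live on a linear order, so points are replaced by their slopes, and
    \<open>e\<close> recovers the point.\<close>
  define V where "V = key ` (S - {x})"
  define e where "e = inv_into (S - {x}) key"
  have e: "e a \<in> S - {x}" "key (e a) = a" if "a \<in> V" for a
    using inv_into_into[of a key "S - {x}"] f_inv_into_f[of a key "S - {x}"] that
    unfolding V_def e_def by blast+
  have ne: "e a \<noteq> e b" if "a \<in> V" "b \<in> V" "a < b" for a b using e that by (metis less_irrefl)
  have injV: "inj_on e V" using e(2) by (rule inj_on_inverseI)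
  have cardV: "card V = card S - 1" unfolding V_def using card_image[OF inj] x(1) fin by simp
  interpret signotope V "\<lambda>a b c. orient (e a) (e b) (e c) < 0"
  proof (rule signotope_around_vertex)
    show "finite V" unfolding V_def using fin by simp
    show "orient (e a) (e b) (e c) \<noteq> 0" if "a \<in> V" "b \<in> V" "c \<in> V" "a < b" "b < c" for a b c
      using nonzero[of "e a" "e b" "e c"] e(1) ne that by (metis DiffD1 less_trans)
    show "orient x (e a) (e b) > 0" if "a \<in> V" "b \<in> V" "a < b" for a b
      using key[of "e a" "e b"] e that by simp
  qed
  have e_pos: "orient (e a) (e b) (e c) > 0"
    if "\<not> orient (e a) (e b) (e c) < 0" "a \<in> V" "b \<in> V" "c \<in> V" "a < b" "b < c" for a b c
    using nonzero[of "e a" "e b" "e c"] e(1) ne that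
    by (metis DiffD1 less_trans not_less_iff_gr_or_eq)
  have eS: "e ` K \<subseteq> S" "card (e ` K) = card K" "x \<notin> e ` K" if "K \<subseteq> V" for K
    using that e(1) card_image[OF inj_on_subset[OF injV that]] by auto
  have "card V \<le> ((2*q + 6) choose (q + 3)) + ((2*q + 5) choose (q + 3)) + ((2*q + 4) choose (q + 4))"
  proof (rule card_le_without_cups_caps_and_covered_cups)
    fix K assume K: "K \<subseteq> V" "cup K"
    show "card K \<noteq> q + 6"
    proof
      assume c: "card K = q + 6"
      \<comment> \<open>Cup triples are clockwise in the order of \<open>key\<close>, hence the
        negated key.\<close>
      have "convex_position (e ` K)"
      proof (rule convex_position_if_orient_pos[where f = "\<lambda>p. - key p"])
        show "3 \<le> card (e ` K)" using eS(2)[OF K(1)] c by simp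
        show "inj_on (\<lambda>p. - key p) (e ` K)" using K(1) e(2) by (auto intro!: inj_onI simp: subset_iff)
        fix p r s assume "p \<in> e ` K" "r \<in> e ` K" "s \<in> e ` K" "- key p < - key r" "- key r < - key s"
        then obtain a b c where "p = e a" "r = e b" "s = e c" "a \<in> K" "b \<in> K" "c \<in> K" "c < b" "b < a"
          using e(2) K(1) by (auto simp: subset_iff)
        then show "orient p r s > 0"
          using homogeneousD[OF K(2), of c b a] orient_reverse[of p r s] by simp
      qed
      then show False using contra eS[OF K(1)] c by auto
    qed
  next
    fix K assume K: "K \<subseteq> V" "cap K"
    show "card K \<noteq> q + 5"
    proof
      assume c: "card K = q + 5"
      let ?T = "insert x (e ` K)"
      have "finite K" using K(1) finite_V finite_subset by blast
      then have cT: "card ?T = q + 6" using eS[OF K(1)] c by simp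
      \<comment> \<open>Cap triples are counterclockwise already, and \<open>x\<close> goes before
        all of them.\<close>
      have "convex_position ?T"
      proof (rule convex_position_if_orient_pos[where f = "\<lambda>p. if p = x then -\<infinity> else ereal (key p)"])
        show "3 \<le> card ?T" using cT by simp
        show "inj_on (\<lambda>p. if p = x then -\<infinity> else ereal (key p)) ?T"
          using K(1) e(2) by (auto intro!: inj_onI simp: subset_iff split: if_splits)
        fix p r s assume *: "p \<in> ?T" "r \<in> ?T" "s \<in> ?T"
          "(if p = x then -\<infinity> else ereal (key p)) < (if r = x then -\<infinity> else ereal (key r))"
          "(if r = x then -\<infinity> else ereal (key r)) < (if s = x then -\<infinity> else ereal (key s))"
        then have "r \<noteq> x" "s \<noteq> x" by auto
        then obtain b c where bc: "r = e b" "s = e c" "b \<in> K" "c \<in> K" using * by auto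
        have "b < c" using *(5) \<open>r \<noteq> x\<close> \<open>s \<noteq> x\<close> bc e(2) K(1) by (auto simp: subset_iff)
        show "orient p r s > 0"
        proof (cases "p = x")
          case True
          then show ?thesis using key[of r s] bc e K(1) \<open>b < c\<close> by (simp add: subset_iff)
        next
          case False
          then obtain a where a: "p = e a" "a \<in> K" using *(1) by auto
          have "a < b" using *(4) False \<open>r \<noteq> x\<close> bc a e(2) K(1) by (auto simp: subset_iff)
          then show ?thesis
            using homogeneousD[OF K(2), of a b c] e_pos[of a b c] a bc \<open>b < c\<close> K(1) by (simp add: subset_iff)
        qed
      qed
      then show False using contra eS(1)[OF K(1)] x(1) cT by auto
    qed
  next
    fix K l r v
    assume K: "K \<subseteq> V" "cup K" and c: "card K = q + 5" and lr: "l \<in> K" "r \<in> K" "\<forall>z\<in>K. l \<le> z \<and> z \<le> r"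
      and v: "v \<in> V" "l < v" "v < r"
    show "orient (e l) (e v) (e r) < 0"
    proof (rule ccontr)
      assume neg: "\<not> orient (e l) (e v) (e r) < 0"
      have vK: "v \<notin> K" using homogeneousD[OF K(2) lr(1) _ lr(2)] v neg by blast
      note covered = covered_cup[OF K lr(1,2) _ v neg]
      let ?T = "insert (e v) (e ` K)"
      have T: "?T \<subseteq> S" "card ?T = q + 6"
        using eS[of "insert v K"] K(1) v(1) card_insert_in_V[OF K(1) vK] c by auto
      \<comment> \<open>The cup is traversed from right to left, with the covering point
        \<open>e v\<close> placed first.\<close>
      have "convex_position ?T"
      proof (rule convex_position_if_orient_pos[where f = "\<lambda>p. if p = e v then -\<infinity> else ereal (- key p)"])
        show "3 \<le> card ?T" using T by simp
        show "inj_on (\<lambda>p. if p = e v then -\<infinity> else ereal (- key p)) ?T"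
          using K(1) e(2) by (auto intro!: inj_onI simp: subset_iff split: if_splits)
        fix p s t assume *: "p \<in> ?T" "s \<in> ?T" "t \<in> ?T"
          "(if p = e v then -\<infinity> else ereal (- key p)) < (if s = e v then -\<infinity> else ereal (- key s))"
          "(if s = e v then -\<infinity> else ereal (- key s)) < (if t = e v then -\<infinity> else ereal (- key t))"
        then have "s \<noteq> e v" "t \<noteq> e v" by auto
        then obtain b c where bc: "s = e b" "t = e c" "b \<in> K" "c \<in> K" using * by auto
        have cb: "c < b" using *(5) \<open>s \<noteq> e v\<close> \<open>t \<noteq> e v\<close> bc e(2) K(1) by (auto simp: subset_iff)
        have V: "b \<in> V" "c \<in> V" using bc K(1) by auto
        show "orient p s t > 0"
        proof (cases "p = e v")
          case True
          \<comment> \<open>Wherever \<open>v\<close> falls relative to \<open>c < b\<close>, the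
            sign rules for covered cups give the same orientation once the triple is brought into
            the order \<open>c\<close>, \<open>b\<close>, \<open>v\<close>.\<close>
          consider "b < v" | "c < v" "v < b" | "v < c" using vK bc cb by (metis linorder_neqE)
          then have "orient (e c) (e b) (e v) < 0"
          proof cases
            case 1
            then show ?thesis using covered(1)[OF _ bc(4,3) cb] lr(3) by blast
          next
            case 2
            then have "orient (e c) (e v) (e b) > 0"
              using covered(2)[OF _ bc(4,3) cb] lr(3) e_pos[of c v b] V v(1) by blast
            then show ?thesis using orient_swap[of "e c" "e v" "e b"] by simp
          next
            case 3
            then have "orient (e v) (e c) (e b) < 0" using covered(3)[OF _ bc(4,3) cb] lr(3) by blast
            then show ?thesis using orient_rotate[of "e c" "e b" "e v"] by simp
          qed
          then show ?thesis using True bc orient_reverse[of "e v" "e b" "e c"] by simp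
        next
          case False
          then obtain a where a: "p = e a" "a \<in> K" using *(1) by auto
          have "b < a" using *(4) False \<open>s \<noteq> e v\<close> bc a e(2) K(1) by (auto simp: subset_iff)
          then show ?thesis
            using homogeneousD[OF K(2), of c b a] a bc cb orient_reverse[of p s t] by simp
        qed
      qed
      then show False using contra T by blast
    qed
  qed
  \<comment> \<open>Of the summand 2 in the size of \<open>S\<close>, one accounts for
    \<open>x\<close>, which is not in \<open>V\<close>, and the other makes \<open>V\<close> exceed
    the bound.\<close>
  then show False using cardV card by simp
qed

section \<open>The bound in closed form\<close>

theorem theorem1:
  fixes n :: nat
  assumes "n \<ge> 6"
  shows "int (ES n) \<le> int ((2*n - 5) choose (n - 2)) - int ((2*n - 8) choose (n - 3)) + 2"
proof -
  obtain q where n: "n = q + 6" using assms by (metis add.commute le_Suc_ex)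
  let ?N = "((2*q + 6) choose (q + 3)) + ((2*q + 5) choose (q + 3)) + ((2*q + 4) choose (q + 4)) + 2"
  have "ES n \<le> ?N"
    unfolding ES_def n by (rule Least_le) (use ex_convex_position in blast)
  \<comment> \<open>Pascal's rule is applied three times, each time to the term with lower index
    \<open>q + 4\<close>. The term with lower index \<open>q + 3\<close> left over at the end is the
    one subtracted in the theorem.\<close>
  moreover have "(2*n - 5) choose (n - 2) = ?N - 2 + ((2*n - 8) choose (n - 3))"
  proof -
    have eq: "2*n - 5 = Suc (2*q + 6)" "n - 2 = q + 4" "2*n - 8 = 2*q + 4" "n - 3 = q + 3"
      using n by auto
    have Suc: "Suc (2*q + 5) = 2*q + 6" "Suc (2*q + 4) = 2*q + 5" "Suc (q + 3) = q + 4" by simp_all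
    show ?thesis
      using binomial_Suc_Suc[of "2*q + 6" "q + 3"] binomial_Suc_Suc[of "2*q + 5" "q + 3"]
        binomial_Suc_Suc[of "2*q + 4" "q + 3"]
      unfolding eq Suc by linarith
  qed
  ultimately show ?thesis by linarith
qed

end
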